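(* The group $\mathrm{GL}(\mathbb{R})$ has commuting $\mathbb{Z}/2$-conjugates but does not have commuting $\mathbb{Z}$-conjugates.
   Context: $\mathrm{GL}(\mathbb{R})$ denotes the infinite general linear group, i.e. the directed union $\bigcup_{n \geq 1} \mathrm{GL}_n(\mathbb{R})$ along the embeddings $A \mapsto \begin{pmatrix} A & 0 \\ 0 & 1 \end{pmatrix}$. We write ${}^t H = tHt^{-1}$. A group $\Gamma$ has *commuting $\mathbb{Z}/2$-conjugates* if for every finitely generated subgroup $H \leq \Gamma$ there exists $t \in \Gamma$ such that $[H, {}^{t} H] = 1$ and $[H, t^2] = 1$. $\Gamma$ has *commuting $\mathbb{Z}$-conjugates* if for every finitely generated subgroup $H \leq \Gamma$ there exists $t \in \Gamma$ such that $[H, {}^{t^p} H] = 1$ for all integers $p \geq 1$. *)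

theory Defs
  imports "HOL-Algebra.Generated_Groups" "Jordan_Normal_Form.Matrix"
begin

section \<open>The infinite general linear group\<close>

definition GL :: "nat \<Rightarrow> real mat monoid" where
  "GL n = units_of (ring_mat TYPE(real) n ())"

text \<open>Elements of the directed union are represented by infinite matrices: a finite matrix is
  identified with all its stabilisations by padding it with the identity along the diagonal.\<close>

definition pad :: "real mat \<Rightarrow> nat \<Rightarrow> nat \<Rightarrow> real" where
  "pad A = (\<lambda>i j. if i < dim_row A \<and> j < dim_col A then A $$ (i, j)
                  else if i = j then 1 else 0)"

text \<open>The matrices in the carrier have finitely many nonzero entries in each row, so the product
  below is the usual matrix product, with the sum restricted to the support of the row.\<close>

definition GL_inf :: "(nat \<Rightarrow> nat \<Rightarrow> real) monoid" where
  "GL_inf = \<lparr> carrier = (\<Union>n\<in>{1..}. pad ` carrier (GL n)),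
              monoid.mult = (\<lambda>A B i j. \<Sum>k | A i k \<noteq> 0. A i k * B k j),
              one = (\<lambda>i j. if i = j then 1 else 0) \<rparr>"


section \<open>Commuting conjugates\<close>

context
  fixes G :: "('a, 'b) monoid_scheme" (structure)
begin

definition fin_gen_subgroup :: "'a set \<Rightarrow> bool" where
  "fin_gen_subgroup H \<longleftrightarrow> (\<exists>S. finite S \<and> S \<subseteq> carrier G \<and> H = generate G S)"

definition conjugate_set :: "'a \<Rightarrow> 'a set \<Rightarrow> 'a set" where
  "conjugate_set t H = (\<lambda>h. t \<otimes> h \<otimes> inv t) ` H"

definition commutator_subgroup :: "'a set \<Rightarrow> 'a set \<Rightarrow> 'a set" where
  "commutator_subgroup A B = generate G {a \<otimes> b \<otimes> inv a \<otimes> inv b | a b. a \<in> A \<and> b \<in> B}"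

definition commuting_Z2_conjugates :: bool where
  "commuting_Z2_conjugates \<longleftrightarrow>
     (\<forall>H. fin_gen_subgroup H \<longrightarrow>
       (\<exists>t\<in>carrier G. commutator_subgroup H (conjugate_set t H) = {\<one>} \<and>
                      commutator_subgroup H {t [^] (2::nat)} = {\<one>}))"

definition commuting_Z_conjugates :: bool where
  "commuting_Z_conjugates \<longleftrightarrow>
     (\<forall>H. fin_gen_subgroup H \<longrightarrow>
       (\<exists>t\<in>carrier G. \<forall>p::int. p \<ge> 1 \<longrightarrow>
          commutator_subgroup H (conjugate_set (t [^] p) H) = {\<one>}))"

end


section \<open>Basic facts\<close>

lemma carrier_GL:
  "A \<in> carrier (GL n) \<longleftrightarrow>
     A \<in> carrier_mat n n \<and> (\<exists>B\<in>carrier_mat n n. B * A = 1\<^sub>m n \<and> A * B = 1\<^sub>m n)"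
  by (auto simp: GL_def units_of_def Units_def ring_mat_simps)

lemma mult_GL: "A \<otimes>\<^bsub>GL n\<^esub> B = A * B"
  by (simp add: GL_def units_of_def ring_mat_simps)

lemma group_GL: "group (GL n)"
proof -
  interpret semiring "ring_mat TYPE(real) n ()" by (rule semiring_mat)
  show ?thesis unfolding GL_def by (rule units_group)
qed

abbreviation stabilise :: "nat \<Rightarrow> nat \<Rightarrow> real mat \<Rightarrow> real mat" where
  "stabilise n k A \<equiv> four_block_mat A (0\<^sub>m n k) (0\<^sub>m k n) (1\<^sub>m k)"

lemma pad_stabilise: "A \<in> carrier_mat n n \<Longrightarrow> pad (stabilise n k A) = pad A"
  by (auto simp: pad_def fun_eq_iff)

lemma stabilise_mult:
  assumes "A \<in> carrier_mat n n" "B \<in> carrier_mat n n"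
  shows "stabilise n k A * stabilise n k B = stabilise n k (A * B)"
  using assms by (subst mult_four_block_mat[of _ n n _ k _ k]) auto

lemma stabilise_one: "stabilise n k (1\<^sub>m n) = 1\<^sub>m (n + k)"
  by auto

lemma stabilise_GL: "A \<in> carrier (GL n) \<Longrightarrow> stabilise n k A \<in> carrier (GL (n + k))"
  unfolding carrier_GL
  by (metis four_block_carrier_mat one_carrier_mat stabilise_mult stabilise_one)

lemma pad_mult:
  assumes A: "A \<in> carrier_mat n n" and B: "B \<in> carrier_mat n n"
  shows "pad A \<otimes>\<^bsub>GL_inf\<^esub> pad B = pad (A * B)"
proof (intro ext)
  fix i j
  have "(\<Sum>k | pad A i k \<noteq> 0. pad A i k * pad B k j) = pad (A * B) i j"
  proof (cases "i < n")
    case True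
    have "(\<Sum>k | pad A i k \<noteq> 0. pad A i k * pad B k j) = (\<Sum>k\<in>{0..<n}. pad A i k * pad B k j)"
      by (rule sum.mono_neutral_left) (use A True in \<open>auto simp: pad_def split: if_splits\<close>)
    also have "\<dots> = pad (A * B) i j"
    proof (cases "j < n")
      case j: True
      then show ?thesis using A B True by (simp add: pad_def scalar_prod_def)
    next
      case False
      then have "(\<Sum>k\<in>{0..<n}. pad A i k * pad B k j) = 0"
        using A B by (intro sum.neutral) (auto simp: pad_def)
      then show ?thesis using A B True False by (simp add: pad_def)
    qed
    finally show ?thesis .
  next
    case False
    then have "{k. pad A i k \<noteq> 0} = {i}" using A by (auto simp: pad_def)
    then show ?thesis using A B False by (auto simp: pad_def)
  qed
  then show "(pad A \<otimes>\<^bsub>GL_inf\<^esub> pad B) i j = pad (A * B) i j"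
    by (simp add: GL_inf_def)
qed

lemma pad_one: "pad (1\<^sub>m n) = \<one>\<^bsub>GL_inf\<^esub>"
  by (auto simp: pad_def GL_inf_def fun_eq_iff)

lemma pad_hom:
  assumes "n \<ge> 1"
  shows "pad \<in> hom (GL n) GL_inf"
proof (rule homI)
  show "pad A \<in> carrier GL_inf" if "A \<in> carrier (GL n)" for A
    using that assms unfolding GL_inf_def by auto
  show "pad (A \<otimes>\<^bsub>GL n\<^esub> B) = pad A \<otimes>\<^bsub>GL_inf\<^esub> pad B"
    if "A \<in> carrier (GL n)" "B \<in> carrier (GL n)" for A B
    using that pad_mult[of A n B] by (simp add: carrier_GL mult_GL)
qed

lemma pad_inj: "inj_on pad (carrier (GL n))"
proof (rule inj_onI)
  fix A B assume *: "A \<in> carrier (GL n)" "B \<in> carrier (GL n)" and eq: "pad A = pad B"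
  show "A = B"
  proof (rule eq_matI)
    fix i j assume "i < dim_row B" "j < dim_col B"
    then show "A $$ (i, j) = B $$ (i, j)"
      using fun_cong[OF fun_cong[OF eq, of i], of j] * by (auto simp: pad_def carrier_GL)
  qed (use * in \<open>auto simp: carrier_GL\<close>)
qed

lemma GL_inf_common_size:
  assumes "finite F" "F \<subseteq> carrier GL_inf"
  obtains n where "n \<ge> 1" "F \<subseteq> pad ` carrier (GL n)"
proof -
  have "\<exists>n\<ge>1. F \<subseteq> pad ` carrier (GL n)"
    using assms
  proof (induction F rule: finite_induct)
    case (insert x F)
    then obtain n where n: "n \<ge> 1" "F \<subseteq> pad ` carrier (GL n)" by auto
    from insert.prems obtain m A where m: "m \<ge> 1" "A \<in> carrier (GL m)" "x = pad A"
      by (auto simp: GL_inf_def)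
    have le: "pad ` carrier (GL a) \<subseteq> pad ` carrier (GL (a + b))" for a b
    proof
      fix y assume "y \<in> pad ` carrier (GL a)"
      then obtain C where "C \<in> carrier (GL a)" "y = pad C" by auto
      then show "y \<in> pad ` carrier (GL (a + b))"
        by (intro image_eqI[of _ _ "stabilise a b C"] stabilise_GL)
          (auto simp: pad_stabilise carrier_GL)
    qed
    have "insert x F \<subseteq> pad ` carrier (GL (n + m))"
      using n m le[of n m] le[of m n] by (auto simp: add.commute)
    then show ?case using n by (intro exI[of _ "n + m"]) auto
  qed auto
  then show thesis using that by blast
qed

lemma group_GL_inf: "group GL_inf"
proof (rule groupI)
  fix x y assume "x \<in> carrier GL_inf" "y \<in> carrier GL_inf"
  then obtain n where "n \<ge> 1" "{x, y} \<subseteq> pad ` carrier (GL n)"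
    using GL_inf_common_size[of "{x, y}"] by auto
  then obtain A B where *: "n \<ge> 1" "A \<in> carrier (GL n)" "B \<in> carrier (GL n)" "x = pad A" "y = pad B"
    by auto
  interpret G: group "GL n" by (rule group_GL)
  have "x \<otimes>\<^bsub>GL_inf\<^esub> y = pad (A \<otimes>\<^bsub>GL n\<^esub> B)" using * hom_mult[OF pad_hom[of n], of A B] by simp
  then show "x \<otimes>\<^bsub>GL_inf\<^esub> y \<in> carrier GL_inf" using * hom_in_carrier[OF pad_hom] by auto
next
  have "1\<^sub>m 1 \<in> carrier (GL 1)" unfolding carrier_GL by (auto intro!: bexI[of _ "1\<^sub>m 1"])
  then show "\<one>\<^bsub>GL_inf\<^esub> \<in> carrier GL_inf"
    using hom_in_carrier[OF pad_hom[of 1]] pad_one[of 1] by (metis order_refl)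
next
  fix x y z assume "x \<in> carrier GL_inf" "y \<in> carrier GL_inf" "z \<in> carrier GL_inf"
  then obtain n where "n \<ge> 1" "{x, y, z} \<subseteq> pad ` carrier (GL n)"
    using GL_inf_common_size[of "{x, y, z}"] by auto
  then obtain A B C where "A \<in> carrier_mat n n" "B \<in> carrier_mat n n" "C \<in> carrier_mat n n"
    "x = pad A" "y = pad B" "z = pad C"
    by (auto simp: carrier_GL)
  then show "x \<otimes>\<^bsub>GL_inf\<^esub> y \<otimes>\<^bsub>GL_inf\<^esub> z = x \<otimes>\<^bsub>GL_inf\<^esub> (y \<otimes>\<^bsub>GL_inf\<^esub> z)"
    by (simp add: pad_mult[of _ n])
next
  fix x assume "x \<in> carrier GL_inf"
  then obtain n A where *: "n \<ge> 1" "A \<in> carrier (GL n)" "x = pad A"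
    by (auto simp: GL_inf_def)
  then have "\<one>\<^bsub>GL_inf\<^esub> \<otimes>\<^bsub>GL_inf\<^esub> x = pad (1\<^sub>m n * A)"
    using pad_one[of n] by (metis carrier_GL one_carrier_mat pad_mult)
  then show "\<one>\<^bsub>GL_inf\<^esub> \<otimes>\<^bsub>GL_inf\<^esub> x = x" using * by (auto simp: carrier_GL)
  from * obtain B where B: "B \<in> carrier_mat n n" "B * A = 1\<^sub>m n" "A * B = 1\<^sub>m n"
    by (auto simp: carrier_GL)
  then have "B \<in> carrier (GL n)" using * unfolding carrier_GL by blast
  then have "pad B \<in> carrier GL_inf" using * hom_in_carrier[OF pad_hom] by auto
  moreover have "pad B \<otimes>\<^bsub>GL_inf\<^esub> x = \<one>\<^bsub>GL_inf\<^esub>"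
    using * B pad_one[of n] pad_mult[of B n A] by (simp add: carrier_GL)
  ultimately show "\<exists>y\<in>carrier GL_inf. y \<otimes>\<^bsub>GL_inf\<^esub> x = \<one>\<^bsub>GL_inf\<^esub>" by blast
qed

lemma (in group) commutator_subgroup_trivial_iff:
  assumes "A \<subseteq> carrier G" "B \<subseteq> carrier G"
  shows "commutator_subgroup G A B = {\<one>} \<longleftrightarrow> (\<forall>a\<in>A. \<forall>b\<in>B. a \<otimes> b = b \<otimes> a)"
proof -
  have comm: "a \<otimes> b \<otimes> inv a \<otimes> inv b = \<one> \<longleftrightarrow> a \<otimes> b = b \<otimes> a"
    if "a \<in> carrier G" "b \<in> carrier G" for a b
  proof -
    have "a \<otimes> b \<otimes> inv a \<otimes> inv b = (a \<otimes> b) \<otimes> inv (b \<otimes> a)"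
      using that by (simp add: inv_mult_group m_assoc)
    also have "\<dots> = \<one> \<longleftrightarrow> a \<otimes> b = b \<otimes> a"
      using that by (metis inv_closed inv_equality inv_inv m_closed r_inv)
    finally show ?thesis .
  qed
  let ?C = "{a \<otimes> b \<otimes> inv a \<otimes> inv b | a b. a \<in> A \<and> b \<in> B}"
  show ?thesis
  proof
    assume *: "commutator_subgroup G A B = {\<one>}"
    have "?C \<subseteq> {\<one>}" using * generate.incl[of _ ?C G] unfolding commutator_subgroup_def by blast
    then show "\<forall>a\<in>A. \<forall>b\<in>B. a \<otimes> b = b \<otimes> a" using comm assms by blast
  next
    assume "\<forall>a\<in>A. \<forall>b\<in>B. a \<otimes> b = b \<otimes> a"
    then have "?C \<subseteq> {\<one>}" using comm assms by blast
    then have "generate G ?C \<subseteq> {\<one>}"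
      using generate_subgroup_incl[OF _ triv_subgroup] by blast
    then show "commutator_subgroup G A B = {\<one>}"
      unfolding commutator_subgroup_def using generate.one[of G ?C] by blast
  qed
qed

end

theory Submission
  imports Defs "Jordan_Normal_Form.Determinant"
begin

text \<open>If \<open>H\<close> consists of \<open>n \<times> n\<close> matrices, the permutation swapping the two
  blocks of size \<open>n\<close> in dimension \<open>2n\<close> is an involution conjugating \<open>H\<close> into the second
  block, where it commutes with \<open>H\<close>.

  For the negative part take \<open>H\<close> generated by two noncommuting elements \<open>a\<close>, \<open>b\<close>.
  If \<open>t\<close> were as required, the conjugates \<open>a\<^sub>p\<close> and \<open>b\<^sub>q\<close> of \<open>a\<close> and \<open>b\<close> by the
  powers \<open>t\<^sup>p\<close> and \<open>t\<^sup>q\<close> would commute exactly when \<open>p \<noteq> q\<close>. Taking the commutator of a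
  linear relation among the \<open>a\<^sub>p\<close> with \<open>b\<^sub>q\<close> kills the \<open>q\<close>-th coefficient, so the \<open>a\<^sub>p\<close> are
  linearly independent. But all of them lie in a single finite-dimensional matrix algebra.\<close>

section \<open>Linear dependence and commuting families of matrices\<close>

text \<open>With \<open>f p\<close> as column \<open>p\<close> and a zero row added at the bottom,
  one gets a singular square matrix; a nonzero kernel vector is the desired
  \<open>c\<close>.\<close>

lemma nontrivial_linear_relation:
  fixes f :: "nat \<Rightarrow> nat \<Rightarrow> 'a :: field"
  obtains c where "\<exists>p\<le>m. c p \<noteq> 0" "\<And>i. i < m \<Longrightarrow> (\<Sum>p\<le>m. c p * f p i) = 0"
proof -
  define M where "M = mat (Suc m) (Suc m) (\<lambda>(i, p). if i < m then f p i else 0)"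
  have M: "M \<in> carrier_mat (Suc m) (Suc m)" by (simp add: M_def)
  have "det M = (\<Sum>p<Suc m. M $$ (m, p) * cofactor M m p)"
    by (rule laplace_expansion_row[OF M]) simp
  also have "\<dots> = 0" by (rule sum.neutral) (simp add: M_def)
  finally obtain v where v: "v \<in> carrier_vec (Suc m)" "v \<noteq> 0\<^sub>v (Suc m)" "M *\<^sub>v v = 0\<^sub>v (Suc m)"
    using det_0_iff_vec_prod_zero_field[OF M] by auto
  have "\<exists>p\<le>m. v $ p \<noteq> 0"
    using v(1,2) by (metis carrier_vecD eq_vecI index_zero_vec less_Suc_eq_le)
  moreover have "(\<Sum>p\<le>m. v $ p * f p i) = 0" if "i < m" for i
  proof -
    have "(M *\<^sub>v v) $ i = (\<Sum>p\<le>m. v $ p * f p i)"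
      using v(1) that
      by (simp add: M_def scalar_prod_def atLeast0LessThan lessThan_Suc_atMost mult.commute)
    then show ?thesis using that by (simp add: v(3))
  qed
  ultimately show thesis by (rule that)
qed

lemma mat_mult_entry:
  "A \<in> carrier_mat n n \<Longrightarrow> B \<in> carrier_mat n n \<Longrightarrow> i < n \<Longrightarrow> j < n \<Longrightarrow>
     (A * B) $$ (i, j) = (\<Sum>k<n. A $$ (i, k) * B $$ (k, j))"
  by (simp add: scalar_prod_def atLeast0LessThan)

text \<open>The \<open>n * n + 1\<close> matrices \<open>A 0\<close>, ..., \<open>A (n * n)\<close>
  are linearly dependent; any index \<open>q\<close> with nonzero coefficient in a relation is a
  suitable \<open>p\<close>.\<close>

lemma commuting_matrix_families:
  fixes A B :: "nat \<Rightarrow> 'a :: field mat"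
  assumes A: "\<And>p. A p \<in> carrier_mat n n" and B: "\<And>p. B p \<in> carrier_mat n n"
    and comm: "\<And>p q. p \<noteq> q \<Longrightarrow> A p * B q = B q * A p"
  shows "\<exists>p. A p * B p = B p * A p"
proof -
  \<comment> \<open>Matrices are flattened to vectors: position \<open>r\<close> stands for row
    \<open>r div n\<close>, column \<open>r mod n\<close>.\<close>
  obtain c where c: "\<exists>p\<le>n * n. c p \<noteq> 0"
    and rel: "\<And>r. r < n * n \<Longrightarrow> (\<Sum>p\<le>n * n. c p * A p $$ (r div n, r mod n)) = 0"
    using nontrivial_linear_relation[of "n * n" "\<lambda>p r. A p $$ (r div n, r mod n)"] by blast
  have rel': "(\<Sum>p\<le>n * n. c p * A p $$ (i, j)) = 0" if "i < n" "j < n" for i j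
  proof -
    have "i * n + j < Suc i * n" using that by simp
    also have "\<dots> \<le> n * n" using that by (intro mult_le_mono1) simp
    finally show ?thesis using rel[of "i * n + j"] that by simp
  qed
  from c obtain q where q: "q \<le> n * n" "c q \<noteq> 0" by blast
  have "A q * B q = B q * A q"
  proof (rule eq_matI)
    fix i j assume "i < dim_row (B q * A q)" "j < dim_col (B q * A q)"
    then have ij: "i < n" "j < n" using A[of q] B[of q] by auto
    \<comment> \<open>Only the \<open>q\<close>-th summand survives \<open>comm\<close>, so this sum
      is an entry of the commutator of the linear combination with \<open>B q\<close>.\<close>
    have "c q * ((A q * B q) $$ (i, j) - (B q * A q) $$ (i, j))
        = (\<Sum>p\<le>n * n. c p * ((A p * B q) $$ (i, j) - (B q * A p) $$ (i, j)))"
    proof -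
      have "(\<Sum>p\<le>n * n. c p * ((A p * B q) $$ (i, j) - (B q * A p) $$ (i, j)))
          = (\<Sum>p\<in>{q}. c p * ((A p * B q) $$ (i, j) - (B q * A p) $$ (i, j)))"
        by (rule sum.mono_neutral_right) (use q comm in auto)
      then show ?thesis by simp
    qed
    also have "\<dots> = (\<Sum>p\<le>n * n. \<Sum>k<n. c p * A p $$ (i, k) * B q $$ (k, j))
                 - (\<Sum>p\<le>n * n. \<Sum>k<n. B q $$ (i, k) * (c p * A p $$ (k, j)))"
      by (simp add: mat_mult_entry[OF A B ij] mat_mult_entry[OF B A ij] right_diff_distrib
          sum_subtractf sum_distrib_left mult_ac)
    \<comment> \<open>Moving the sum over \<open>p\<close> inside exposes the entries of the linear
      combination, which vanish by \<open>rel'\<close>.\<close>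
    also have "\<dots> = (\<Sum>k<n. (\<Sum>p\<le>n * n. c p * A p $$ (i, k)) * B q $$ (k, j))
                 - (\<Sum>k<n. B q $$ (i, k) * (\<Sum>p\<le>n * n. c p * A p $$ (k, j)))"
      unfolding sum_distrib_left sum_distrib_right by (subst (1 2) sum.swap) (rule refl)
    also have "\<dots> = 0" using ij by (simp add: rel')
    finally show "(A q * B q) $$ (i, j) = (B q * A q) $$ (i, j)" using q(2) by simp
  qed (use A[of q] B[of q] in auto)
  then show ?thesis ..
qed

section \<open>Conjugation by powers in an abstract group\<close>

context group
begin

lemma conj_mult:
  assumes "g \<in> carrier G" "x \<in> carrier G" "y \<in> carrier G"
  shows "(g \<otimes> x \<otimes> inv g) \<otimes> (g \<otimes> y \<otimes> inv g) = g \<otimes> (x \<otimes> y) \<otimes> inv g"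
proof -
  have "inv g \<otimes> (g \<otimes> (y \<otimes> inv g)) = y \<otimes> inv g"
    using assms by (simp add: m_assoc[symmetric])
  then show ?thesis using assms by (simp add: m_assoc)
qed

lemma conj_conj:
  assumes "g \<in> carrier G" "h \<in> carrier G" "x \<in> carrier G"
  shows "g \<otimes> (h \<otimes> x \<otimes> inv h) \<otimes> inv g = (g \<otimes> h) \<otimes> x \<otimes> inv (g \<otimes> h)"
  using assms by (simp add: inv_mult_group m_assoc)

lemma conjugate_set_carrier:
  "t \<in> carrier G \<Longrightarrow> H \<subseteq> carrier G \<Longrightarrow> conjugate_set G t H \<subseteq> carrier G"
  by (auto simp: conjugate_set_def)

text \<open>For \<open>p < q\<close>, both elements are conjugates by \<open>t [^] p\<close>, of
  \<open>x\<close> and of a conjugate of \<open>y\<close> by the positive power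
  \<open>t [^] (q - p)\<close>; these commute by hypothesis.\<close>

lemma commuting_power_conjugates:
  assumes t: "t \<in> carrier G" and H: "H \<subseteq> carrier G"
    and comm: "\<And>p::int. p \<ge> 1 \<Longrightarrow>
      commutator_subgroup G H (conjugate_set G (t [^] p) H) = {\<one>}"
    and xy: "x \<in> H" "y \<in> H" and neq: "p \<noteq> (q::nat)"
  shows "(t [^] p \<otimes> x \<otimes> inv (t [^] p)) \<otimes> (t [^] q \<otimes> y \<otimes> inv (t [^] q))
       = (t [^] q \<otimes> y \<otimes> inv (t [^] q)) \<otimes> (t [^] p \<otimes> x \<otimes> inv (t [^] p))"
proof -
  have less: "(t [^] p \<otimes> x \<otimes> inv (t [^] p)) \<otimes> (t [^] q \<otimes> y \<otimes> inv (t [^] q))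
       = (t [^] q \<otimes> y \<otimes> inv (t [^] q)) \<otimes> (t [^] p \<otimes> x \<otimes> inv (t [^] p))"
    if "x \<in> H" "y \<in> H" "p < q" for x y and p q :: nat
  proof -
    define r where "r = q - p"
    have q: "q = p + r" and r: "int r \<ge> 1" using that by (auto simp: r_def)
    define z where "z = t [^] r \<otimes> y \<otimes> inv (t [^] r)"
    have c: "x \<in> carrier G" "y \<in> carrier G" using that H by auto
    have z: "z \<in> carrier G" using c t by (simp add: z_def)
    have "z \<in> conjugate_set G (t [^] int r) H"
      using that by (auto simp: z_def conjugate_set_def int_pow_int)
    then have xz: "x \<otimes> z = z \<otimes> x"
      using comm[OF r] commutator_subgroup_trivial_iff[OF H conjugate_set_carrier[OF _ H]]
        int_pow_closed[OF t] \<open>x \<in> H\<close> by blast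
    have "t [^] q \<otimes> y \<otimes> inv (t [^] q) = t [^] p \<otimes> z \<otimes> inv (t [^] p)"
      using t c unfolding q z_def by (simp add: conj_conj nat_pow_mult)
    then show ?thesis using t c z by (simp add: conj_mult xz)
  qed
  show ?thesis
  proof (cases "p < q")
    case True
    then show ?thesis by (rule less[OF xy])
  next
    case False
    \<comment> \<open>The case \<open>q < p\<close> is the previous one with \<open>x\<close> and
      \<open>y\<close> exchanged.\<close>
    then show ?thesis using neq less[OF xy(2,1), of q p] by simp
  qed
qed

end

section \<open>The finite-dimensional obstruction and a noncommuting pair\<close>

lemma pad_GL_subgroup: "n \<ge> 1 \<Longrightarrow> subgroup (pad ` carrier (GL n)) GL_inf"
  using group_hom.img_is_subgroup[of "GL n" GL_inf pad] pad_hom group_GL group_GL_inf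
  by (simp add: group_hom_def group_hom_axioms_def)

text \<open>A common size \<open>n\<close> for \<open>t\<close>, \<open>a\<close>, \<open>b\<close>
  also serves all conjugates by powers of \<open>t\<close>, so the result on matrix families
  applies. It yields one \<open>p\<close> where the two conjugates commute, hence \<open>a\<close>
  and \<open>b\<close> would commute.\<close>

lemma GL_inf_no_commuting_families:
  assumes t: "t \<in> carrier GL_inf" and ab: "a \<in> carrier GL_inf" "b \<in> carrier GL_inf"
    and neq: "a \<otimes>\<^bsub>GL_inf\<^esub> b \<noteq> b \<otimes>\<^bsub>GL_inf\<^esub> a"
  defines "cj \<equiv> \<lambda>(p::nat) x. t [^]\<^bsub>GL_inf\<^esub> p \<otimes>\<^bsub>GL_inf\<^esub> x \<otimes>\<^bsub>GL_inf\<^esub> inv\<^bsub>GL_inf\<^esub> (t [^]\<^bsub>GL_inf\<^esub> p)"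
  shows "\<exists>p q. p \<noteq> q \<and> cj p a \<otimes>\<^bsub>GL_inf\<^esub> cj q b \<noteq> cj q b \<otimes>\<^bsub>GL_inf\<^esub> cj p a"
proof (rule ccontr)
  interpret group GL_inf by (rule group_GL_inf)
  assume "\<not> ?thesis"
  then have comm: "cj p a \<otimes>\<^bsub>GL_inf\<^esub> cj q b = cj q b \<otimes>\<^bsub>GL_inf\<^esub> cj p a"
    if "p \<noteq> q" for p q using that by blast
  obtain n where n: "n \<ge> 1" "{t, a, b} \<subseteq> pad ` carrier (GL n)"
    using GL_inf_common_size[of "{t, a, b}"] t ab by auto
  interpret S: subgroup "pad ` carrier (GL n)" GL_inf by (rule pad_GL_subgroup[OF n(1)])
  have pow: "t [^]\<^bsub>GL_inf\<^esub> p \<in> pad ` carrier (GL n)" for p :: nat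
    using n(2) by (induction p) auto
  have "cj p x \<in> pad ` carrier (GL n)" if "x \<in> {a, b}" for p x
    unfolding cj_def using that n(2) pow[of p] by (intro S.m_closed S.m_inv_closed) auto
  \<comment> \<open>Preimages under \<open>pad\<close> are chosen for all \<open>p\<close> at once;
    injectivity of \<open>pad\<close> then carries commutation both ways.\<close>
  then obtain A B where A: "\<And>p. A p \<in> carrier (GL n)" "\<And>p. cj p a = pad (A p)"
    and B: "\<And>p. B p \<in> carrier (GL n)" "\<And>p. cj p b = pad (B p)"
    by (simp add: image_iff Bex_def) metis
  have Am: "A p \<in> carrier_mat n n" and Bm: "B p \<in> carrier_mat n n" for p
    using A(1) B(1) by (auto simp: carrier_GL)
  have iff: "A p * B q = B q * A p \<longleftrightarrow>
      cj p a \<otimes>\<^bsub>GL_inf\<^esub> cj q b = cj q b \<otimes>\<^bsub>GL_inf\<^esub> cj p a" for p q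
  proof -
    interpret GLn: group "GL n" by (rule group_GL)
    have "A p * B q \<in> carrier (GL n)" "B q * A p \<in> carrier (GL n)"
      using GLn.m_closed[OF A(1) B(1)] GLn.m_closed[OF B(1) A(1)] by (simp_all add: mult_GL)
    then show ?thesis
      using inj_on_eq_iff[OF pad_inj] by (simp add: A(2) B(2) pad_mult[OF Am Bm] pad_mult[OF Bm Am])
  qed
  obtain p where "A p * B p = B p * A p"
    using commuting_matrix_families[of A n B] Am Bm comm iff by blast
  then have "cj p (a \<otimes>\<^bsub>GL_inf\<^esub> b) = cj p (b \<otimes>\<^bsub>GL_inf\<^esub> a)"
    using iff[of p p] t ab by (simp add: cj_def conj_mult)
  then show False using neq t ab by (simp add: cj_def)
qed

text \<open>The witnesses are unipotent upper and lower triangular matrices; additivity in the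
  parameter makes \<open>U (-1)\<close> and \<open>L (-1)\<close> their inverses. The two products
  have corner entries 2 and 1.\<close>

lemma GL_inf_not_commutative:
  obtains a b where "a \<in> carrier GL_inf" "b \<in> carrier GL_inf"
    "a \<otimes>\<^bsub>GL_inf\<^esub> b \<noteq> b \<otimes>\<^bsub>GL_inf\<^esub> a"
proof -
  define U where "U x = mat 2 2 (\<lambda>(i, j). if i = j then 1 else if i < j then x else 0)" for x :: real
  define L where "L x = mat 2 2 (\<lambda>(i, j). if i = j then 1 else if j < i then x else 0)" for x :: real
  have U: "U x \<in> carrier_mat 2 2" and L: "L x \<in> carrier_mat 2 2" for x
    by (simp_all add: U_def L_def)
  have UU: "U x * U y = U (x + y)" and LL: "L x * L y = L (x + y)" for x y
    by (auto intro!: eq_matI simp: U_def L_def scalar_prod_def numeral_2_eq_2 less_Suc_eq)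
  have 0: "U 0 = 1\<^sub>m 2" "L 0 = 1\<^sub>m 2"
    by (auto intro!: eq_matI simp: U_def L_def)
  have UG: "U 1 \<in> carrier (GL 2)" and LG: "L 1 \<in> carrier (GL 2)"
    using U L UU[of 1 "-1"] UU[of "-1" 1] LL[of 1 "-1"] LL[of "-1" 1] 0
    unfolding carrier_GL by auto
  have "(U 1 * L 1) $$ (0, 0) \<noteq> (L 1 * U 1) $$ (0, 0)"
    by (simp add: U_def L_def scalar_prod_def numeral_2_eq_2)
  then have "U 1 * L 1 \<noteq> L 1 * U 1" by metis
  moreover have "U 1 * L 1 \<in> carrier (GL 2)" "L 1 * U 1 \<in> carrier (GL 2)"
    using group.is_monoid[OF group_GL[of 2], THEN monoid.m_closed] UG LG
    by (simp_all add: mult_GL)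
  ultimately have "pad (U 1) \<otimes>\<^bsub>GL_inf\<^esub> pad (L 1) \<noteq> pad (L 1) \<otimes>\<^bsub>GL_inf\<^esub> pad (U 1)"
    using inj_on_eq_iff[OF pad_inj] by (simp add: pad_mult[OF U L] pad_mult[OF L U])
  then show thesis
    using that[of "pad (U 1)" "pad (L 1)"] hom_in_carrier[OF pad_hom[of 2]] UG LG by simp
qed

section \<open>The block swap and commuting Z/2-conjugates\<close>

text \<open>Multiplication by \<open>T\<close> exchanges the block rows from the left and the block
  columns from the right.\<close>

lemma swap_block_conj:
  assumes A: "A \<in> carrier_mat n n"
  defines "T \<equiv> four_block_mat (0\<^sub>m n n) (1\<^sub>m n) (1\<^sub>m n) (0\<^sub>m n n :: 'a :: comm_ring_1 mat)"
  shows "T * T = 1\<^sub>m (n + n)"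
    and "T * four_block_mat A (0\<^sub>m n n) (0\<^sub>m n n) (1\<^sub>m n) * T
         = four_block_mat (1\<^sub>m n) (0\<^sub>m n n) (0\<^sub>m n n) A"
proof -
  show "T * T = 1\<^sub>m (n + n)"
    unfolding T_def by (subst mult_four_block_mat[of _ n n _ n _ n]) auto
  have "T * four_block_mat A (0\<^sub>m n n) (0\<^sub>m n n) (1\<^sub>m n)
      = four_block_mat (0\<^sub>m n n) (1\<^sub>m n) A (0\<^sub>m n n)"
    unfolding T_def using A by (subst mult_four_block_mat[of _ n n _ n _ n]) auto
  then show "T * four_block_mat A (0\<^sub>m n n) (0\<^sub>m n n) (1\<^sub>m n) * T
         = four_block_mat (1\<^sub>m n) (0\<^sub>m n n) (0\<^sub>m n n) A"
    unfolding T_def using A by (simp, subst mult_four_block_mat[of _ n n _ n _ n]) auto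
qed

text \<open>Both products are the block diagonal matrix with blocks \<open>A\<close> and
  \<open>B\<close>.\<close>

lemma diagonal_blocks_commute:
  assumes "A \<in> carrier_mat n n" "B \<in> carrier_mat n n"
  shows "four_block_mat A (0\<^sub>m n n) (0\<^sub>m n n) (1\<^sub>m n) * four_block_mat (1\<^sub>m n) (0\<^sub>m n n) (0\<^sub>m n n) B
       = four_block_mat (1\<^sub>m n) (0\<^sub>m n n) (0\<^sub>m n n) (B :: 'a :: comm_ring_1 mat)
         * four_block_mat A (0\<^sub>m n n) (0\<^sub>m n n) (1\<^sub>m n)"
  using assms by (subst (1 2) mult_four_block_mat[of _ n n _ n _ n]) auto

lemma GL_inf_commuting_Z2: "commuting_Z2_conjugates GL_inf"
  unfolding commuting_Z2_conjugates_def
proof (intro allI impI)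
  interpret group GL_inf by (rule group_GL_inf)
  fix H assume "fin_gen_subgroup GL_inf H"
  then obtain S where S: "finite S" "S \<subseteq> carrier GL_inf" "H = generate GL_inf S"
    by (auto simp: fin_gen_subgroup_def)
  then obtain n where n: "n \<ge> 1" "S \<subseteq> pad ` carrier (GL n)"
    using GL_inf_common_size by metis
  have Hn: "H \<subseteq> pad ` carrier (GL n)"
    unfolding S(3) by (rule generate_subgroup_incl[OF n(2) pad_GL_subgroup[OF n(1)]])
  have H: "H \<subseteq> carrier GL_inf" unfolding S(3) by (rule generate_incl[OF S(2)])
  define T :: "real mat" where "T = four_block_mat (0\<^sub>m n n) (1\<^sub>m n) (1\<^sub>m n) (0\<^sub>m n n)"
  define t where "t = pad T"
  have T: "T \<in> carrier_mat (n + n) (n + n)" by (simp add: T_def)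
  have TT: "T * T = 1\<^sub>m (n + n)"
    unfolding T_def by (rule swap_block_conj(1)[of "1\<^sub>m n"]) simp
  have "T \<in> carrier (GL (n + n))" unfolding carrier_GL using T TT by blast
  then have t: "t \<in> carrier GL_inf"
    unfolding t_def using n(1) by (intro hom_in_carrier[OF pad_hom]) auto
  have tt: "t \<otimes>\<^bsub>GL_inf\<^esub> t = \<one>\<^bsub>GL_inf\<^esub>"
    unfolding t_def by (simp add: pad_mult[OF T T] TT pad_one)
  have inv: "inv\<^bsub>GL_inf\<^esub> t = t" using tt t by (intro inv_equality)
  have "commutator_subgroup GL_inf H (conjugate_set GL_inf t H) = {\<one>\<^bsub>GL_inf\<^esub>}"
    unfolding commutator_subgroup_trivial_iff[OF H conjugate_set_carrier[OF t H]]
  proof (intro ballI)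
    fix x y assume "x \<in> H" "y \<in> conjugate_set GL_inf t H"
    moreover obtain h where "h \<in> H" "y = t \<otimes>\<^bsub>GL_inf\<^esub> h \<otimes>\<^bsub>GL_inf\<^esub> inv\<^bsub>GL_inf\<^esub> t"
      using calculation(2) by (auto simp: conjugate_set_def)
    ultimately obtain A B where A: "A \<in> carrier_mat n n" "x = pad A"
      and B: "B \<in> carrier_mat n n" "y = t \<otimes>\<^bsub>GL_inf\<^esub> pad B \<otimes>\<^bsub>GL_inf\<^esub> inv\<^bsub>GL_inf\<^esub> t"
      using subsetD[OF Hn] unfolding image_iff Bex_def carrier_GL by metis
    let ?B = "four_block_mat (1\<^sub>m n) (0\<^sub>m n n) (0\<^sub>m n n) B"
    have sA: "stabilise n n A \<in> carrier_mat (n + n) (n + n)"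
      and sB: "stabilise n n B \<in> carrier_mat (n + n) (n + n)"
      and B': "?B \<in> carrier_mat (n + n) (n + n)" using A B by auto
    \<comment> \<open>\<open>B\<close> is first enlarged to the size of \<open>T\<close>, since
      \<open>pad_mult\<close> multiplies matrices of equal size; \<open>t\<close> is its own
      inverse.\<close>
    have "y = pad (T * stabilise n n B * T)"
      unfolding B(2) inv unfolding pad_stabilise[OF B(1), of n, symmetric] t_def
      by (simp only: pad_mult[OF T sB] pad_mult[OF mult_carrier_mat[OF T sB] T])
    also have "\<dots> = pad ?B" unfolding T_def swap_block_conj(2)[OF B(1)] ..
    finally have y: "y = pad ?B" .
    have x: "x = pad (stabilise n n A)" by (simp only: A(2) pad_stabilise[OF A(1)])
    show "x \<otimes>\<^bsub>GL_inf\<^esub> y = y \<otimes>\<^bsub>GL_inf\<^esub> x"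
      unfolding x y pad_mult[OF sA B'] pad_mult[OF B' sA] diagonal_blocks_commute[OF A(1) B(1)] ..
  qed
  moreover have "commutator_subgroup GL_inf H {t [^]\<^bsub>GL_inf\<^esub> (2::nat)} = {\<one>\<^bsub>GL_inf\<^esub>}"
  proof -
    have "t [^]\<^bsub>GL_inf\<^esub> (2::nat) = \<one>\<^bsub>GL_inf\<^esub>" using t tt by (simp add: numeral_2_eq_2)
    then show ?thesis
      using H by (subst commutator_subgroup_trivial_iff) auto
  qed
  ultimately show "\<exists>t\<in>carrier GL_inf.
      commutator_subgroup GL_inf H (conjugate_set GL_inf t H) = {\<one>\<^bsub>GL_inf\<^esub>} \<and>
      commutator_subgroup GL_inf H {t [^]\<^bsub>GL_inf\<^esub> (2::nat)} = {\<one>\<^bsub>GL_inf\<^esub>}"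
    using t by blast
qed

section \<open>Failure of commuting Z-conjugates\<close>

lemma GL_inf_not_commuting_Z: "\<not> commuting_Z_conjugates GL_inf"
proof
  interpret group GL_inf by (rule group_GL_inf)
  assume Z: "commuting_Z_conjugates GL_inf"
  obtain a b where ab: "a \<in> carrier GL_inf" "b \<in> carrier GL_inf"
    "a \<otimes>\<^bsub>GL_inf\<^esub> b \<noteq> b \<otimes>\<^bsub>GL_inf\<^esub> a" by (rule GL_inf_not_commutative)
  define H where "H = generate GL_inf {a, b}"
  have H: "H \<subseteq> carrier GL_inf" "a \<in> H" "b \<in> H"
    using ab generate_incl[of "{a, b}"] by (auto simp: H_def intro: generate.incl)
  have "fin_gen_subgroup GL_inf H"
    unfolding fin_gen_subgroup_def H_def using ab by (intro exI[of _ "{a, b}"]) auto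
  then obtain t where t: "t \<in> carrier GL_inf"
    and "\<And>p::int. p \<ge> 1 \<Longrightarrow>
      commutator_subgroup GL_inf H (conjugate_set GL_inf (t [^]\<^bsub>GL_inf\<^esub> p) H) = {\<one>\<^bsub>GL_inf\<^esub>}"
    using Z unfolding commuting_Z_conjugates_def by blast
  \<comment> \<open>The hypothesis on positive powers makes the conjugates of \<open>a\<close> and
    \<open>b\<close> commute for all distinct natural exponents, which the obstruction
    excludes.\<close>
  then show False
    using GL_inf_no_commuting_families[OF t ab] commuting_power_conjugates[OF t H(1) _ H(2,3)]
    by blast
qed

theorem proposition3p7:
  shows "commuting_Z2_conjugates GL_inf \<and> \<not> commuting_Z_conjugates GL_inf"
  using GL_inf_commuting_Z2 GL_inf_not_commuting_Z ..

end
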